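(* Let $\overline{R}=\{R,+,-,\times,\div,<,0,1\}$ be the real number structure, let $r\neq 0$ be a real number value in $\overline{R}$, and let $\overline{R}^{r}$ and $\overline{R}_{r}$ be the external and internal representations of the structure scaled by $r$. Then $\overline{R}_{r}$ is complete if and only if $\overline{R}^{r}$ is complete if and only if $\overline{R}$ is complete.
   Context: $\overline{R}$ is an ordered field structure satisfying the real number axioms; elements of $R$ are identified with their values in $\overline{R}$. External representation: for $r>0$, $\overline{R}^{r}=\{R,+,-,\frac{\times}{r},r\div,<,0,r\}$, the structure on the same set $R$ with the same $+,-,<$ as $\overline{R}$, with multiplication $x\,\frac{\times}{r}\,y:=(x\times y)\div r$, division $x\,(r\div)\,y:=r\times(x\div y)$, additive identity $0$ and multiplicative identity $r$ (right-hand sides computed in $\overline{R}$). For $r<0$ the definition is the same except that $<$ is replaced by $>$, i.e. $x$ is less than $y$ in $\overline{R}^{r}$ if and only if $x>y$ in $\overline{R}$. Internal representation: $\overline{R}_{r}=\{R,+_{r},-_{r},\times_{r},\div_{r},<_{r},0_{r},1_{r}\}$ is the same structure with values renamed: the element whose value in $\overline{R}$ is $ra$ has value denoted $a_{r}$ in $\overline{R}_{r}$, and the operations, the order relation and the constants are those of $\overline{R}^{r}$ transported along this renaming. Convergence and completeness: in any of these structures, a sequence $\{x_{j}\}$ converges if for every positive $\epsilon$ of that structure there exists $h$ such that for all $j,m>h$ the absolute value of $x_{j}-x_{m}$ is less than $\epsilon$ (subtraction, order, positivity and absolute value being those of that structure; the absolute value of $x$ in $\overline{R}^{r}$ is $|x|$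 if $r>0$ and $-|x|$ if $r<0$, where $|\cdot|$ is the absolute value in $\overline{R}$). The structure is complete if for every sequence $\{x_{j}\}$ that converges in this sense there is a value $\mu$ in the structure with $\lim_{j\to\infty}x_{j}=\mu$, i.e. for every positive $\epsilon$ there is $h$ such that for all $j>h$ the absolute value of $x_{j}-\mu$ is less than $\epsilon$. *)

theory Defs
  imports Complex_Main "HOL-Algebra.Ring"
begin

text \<open>Structures with the signature of an ordered field, where subtraction, division and
  the order are primitive components. Nothing is assumed about \<open>quot x \<zero>\<close>.\<close>

record 'a of_struct = "'a ring" +
  diff :: "'a \<Rightarrow> 'a \<Rightarrow> 'a"
  quot :: "'a \<Rightarrow> 'a \<Rightarrow> 'a"
  less :: "'a \<Rightarrow> 'a \<Rightarrow> bool" (infix \<open>\<prec>\<index>\<close> 50)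

locale real_structure = field R for R :: "'a of_struct" (structure) +
  assumes diff_eq: "\<lbrakk>x \<in> carrier R; y \<in> carrier R\<rbrakk> \<Longrightarrow> diff R x y = x \<ominus> y"
    and quot_eq: "\<lbrakk>x \<in> carrier R; y \<in> carrier R; y \<noteq> \<zero>\<rbrakk> \<Longrightarrow> quot R x y = x \<otimes> inv y"
    and less_irrefl: "x \<in> carrier R \<Longrightarrow> \<not> x \<prec> x"
    and less_trans:
      "\<lbrakk>x \<in> carrier R; y \<in> carrier R; z \<in> carrier R; x \<prec> y; y \<prec> z\<rbrakk> \<Longrightarrow> x \<prec> z"
    and less_linear: "\<lbrakk>x \<in> carrier R; y \<in> carrier R\<rbrakk> \<Longrightarrow> x \<prec> y \<or> x = y \<or> y \<prec> x"
    and add_less_mono: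
      "\<lbrakk>x \<in> carrier R; y \<in> carrier R; z \<in> carrier R; x \<prec> y\<rbrakk> \<Longrightarrow> x \<oplus> z \<prec> y \<oplus> z"
    and mult_pos_pos:
      "\<lbrakk>x \<in> carrier R; y \<in> carrier R; \<zero> \<prec> x; \<zero> \<prec> y\<rbrakk> \<Longrightarrow> \<zero> \<prec> x \<otimes> y"
    and least_upper_bound:
      "\<lbrakk>A \<subseteq> carrier R; A \<noteq> {}; \<exists>b\<in>carrier R. \<forall>a\<in>A. a \<prec> b \<or> a = b\<rbrakk> \<Longrightarrow>
        \<exists>s\<in>carrier R. (\<forall>a\<in>A. a \<prec> s \<or> a = s) \<and>
          (\<forall>b\<in>carrier R. (\<forall>a\<in>A. a \<prec> b \<or> a = b) \<longrightarrow> s \<prec> b \<or> s = b)"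

text \<open>Only meaningful for \<open>r \<noteq> \<zero>\<close>; the order is reversed when \<open>r\<close> is negative.\<close>

definition external_rep :: "'a of_struct \<Rightarrow> 'a \<Rightarrow> 'a of_struct" where
  "external_rep R r =
    \<lparr>carrier = carrier R,
     mult = (\<lambda>x y. quot R (x \<otimes>\<^bsub>R\<^esub> y) r),
     one = r,
     zero = \<zero>\<^bsub>R\<^esub>,
     add = add R,
     diff = diff R,
     quot = (\<lambda>x y. r \<otimes>\<^bsub>R\<^esub> quot R x y),
     less = (if \<zero>\<^bsub>R\<^esub> \<prec>\<^bsub>R\<^esub> r then less R else (\<lambda>x y. y \<prec>\<^bsub>R\<^esub> x))\<rparr>"

text \<open>Transport of a structure along a renaming \<open>f\<close>, assumed injective on the carrier.\<close>

definition transport :: "('a \<Rightarrow> 'b) \<Rightarrow> 'a of_struct \<Rightarrow> 'b of_struct" where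
  "transport f S =
    (let g = inv_into (carrier S) f in
    \<lparr>carrier = f ` carrier S,
     mult = (\<lambda>x y. f (g x \<otimes>\<^bsub>S\<^esub> g y)),
     one = f \<one>\<^bsub>S\<^esub>,
     zero = f \<zero>\<^bsub>S\<^esub>,
     add = (\<lambda>x y. f (g x \<oplus>\<^bsub>S\<^esub> g y)),
     diff = (\<lambda>x y. f (diff S (g x) (g y))),
     quot = (\<lambda>x y. f (quot S (g x) (g y))),
     less = (\<lambda>x y. g x \<prec>\<^bsub>S\<^esub> g y)\<rparr>)"

text \<open>\<open>Val a r\<close> is the value \<open>a\<^sub>r\<close>.\<close>

datatype 'a scaled_value = Val 'a 'a

definition rename :: "'a of_struct \<Rightarrow> 'a \<Rightarrow> 'a \<Rightarrow> 'a scaled_value" where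
  "rename R r x = Val (quot R x r) r"

definition internal_rep :: "'a of_struct \<Rightarrow> 'a \<Rightarrow> 'a scaled_value of_struct" where
  "internal_rep R r = transport (rename R r) (external_rep R r)"

definition abs_val :: "'a of_struct \<Rightarrow> 'a \<Rightarrow> 'a" where
  "abs_val S x = (if x \<prec>\<^bsub>S\<^esub> \<zero>\<^bsub>S\<^esub> then diff S \<zero>\<^bsub>S\<^esub> x else x)"

definition converges :: "'a of_struct \<Rightarrow> (nat \<Rightarrow> 'a) \<Rightarrow> bool" where
  "converges S x \<longleftrightarrow>
    (\<forall>\<epsilon>\<in>carrier S. \<zero>\<^bsub>S\<^esub> \<prec>\<^bsub>S\<^esub> \<epsilon> \<longrightarrow>
      (\<exists>h. \<forall>j>h. \<forall>m>h. abs_val S (diff S (x j) (x m)) \<prec>\<^bsub>S\<^esub> \<epsilon>))"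

definition has_limit :: "'a of_struct \<Rightarrow> (nat \<Rightarrow> 'a) \<Rightarrow> 'a \<Rightarrow> bool" where
  "has_limit S x \<mu> \<longleftrightarrow>
    (\<forall>\<epsilon>\<in>carrier S. \<zero>\<^bsub>S\<^esub> \<prec>\<^bsub>S\<^esub> \<epsilon> \<longrightarrow>
      (\<exists>h. \<forall>j>h. abs_val S (diff S (x j) \<mu>) \<prec>\<^bsub>S\<^esub> \<epsilon>))"

definition complete_struct :: "'a of_struct \<Rightarrow> bool" where
  "complete_struct S \<longleftrightarrow>
    (\<forall>x. (\<forall>j. x j \<in> carrier S) \<longrightarrow> converges S x \<longrightarrow>
      (\<exists>\<mu>\<in>carrier S. has_limit S x \<mu>))"

context real_structure
begin

lemma rename_mult:
  assumes "r \<in> carrier R" "r \<noteq> \<zero>" "a \<in> carrier R"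
  shows "rename R r (r \<otimes> a) = Val a r"
proof -
  have u: "r \<in> Units R" using assms field_Units by auto
  have "quot R (r \<otimes> a) r = (r \<otimes> a) \<otimes> inv r" using assms by (simp add: quot_eq)
  also have "\<dots> = (a \<otimes> r) \<otimes> inv r" using assms by (simp add: m_comm)
  also have "\<dots> = a" using assms u by (simp add: m_assoc)
  finally show ?thesis by (simp add: rename_def)
qed

text \<open>The absolute value of \<open>external_rep R r\<close> is that of \<open>R\<close> for positive \<open>r\<close>
  and its negative for negative \<open>r\<close>.\<close>

lemma abs_val_external_rep_pos:
  "\<zero> \<prec> r \<Longrightarrow> abs_val (external_rep R r) x = abs_val R x"
  by (simp add: abs_val_def external_rep_def)

lemma abs_val_external_rep_neg:
  assumes r: "r \<in> carrier R" "r \<prec> \<zero>" and x: "x \<in> carrier R"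
  shows "abs_val (external_rep R r) x = \<ominus> abs_val R x"
proof -
  have "\<not> \<zero> \<prec> r" using less_trans[of \<zero> r \<zero>] less_irrefl[of \<zero>] r by auto
  moreover have "\<not> (\<zero> \<prec> x \<and> x \<prec> \<zero>)"
    using less_trans[of \<zero> x \<zero>] less_irrefl[of \<zero>] x by auto
  moreover have "\<zero> \<prec> x \<or> x = \<zero> \<or> x \<prec> \<zero>" using less_linear x by blast
  moreover have "diff R \<zero> x = \<ominus> x" using x by (simp add: diff_eq a_minus_def)
  ultimately show ?thesis using x less_irrefl[of \<zero>]
    by (auto simp: abs_val_def external_rep_def)
qed

end

definition real_of_struct :: "real of_struct" where
  "real_of_struct = \<lparr>carrier = UNIV, mult = (*), one = 1, zero = 0, add = (+),
     diff = (-), quot = (/), less = (<)\<rparr>"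

lemma real_structure_real: "real_structure real_of_struct"
proof -
  let ?R = real_of_struct
  have c: "cring ?R"
    by (rule cringI; (rule abelian_groupI comm_monoidI)?)
      (auto simp: real_of_struct_def algebra_simps intro: exI[of _ "- x" for x])
  have U: "Units ?R = carrier ?R - {\<zero>\<^bsub>?R\<^esub>}"
    by (auto simp: Units_def real_of_struct_def intro: exI[of _ "1 / x" for x])
  interpret F: field ?R using c U by (rule cring.cring_fieldI)
  have minus: "a_minus ?R x y = x - y" for x y
  proof -
    have "a_inv ?R y = - y"
      by (rule F.minus_equality) (auto simp: real_of_struct_def)
    then show ?thesis by (simp add: a_minus_def real_of_struct_def)
  qed
  have minv: "m_inv ?R y = 1 / y" if "y \<noteq> 0" for y
    by (rule F.comm_inv_char) (use that in \<open>auto simp: real_of_struct_def\<close>)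
  show ?thesis
  proof
    fix A :: "real set"
    assume "A \<noteq> {}"
      and "\<exists>b\<in>carrier ?R. \<forall>a\<in>A. a \<prec>\<^bsub>?R\<^esub> b \<or> a = b"
    then have ne: "A \<noteq> {}" and bdd: "bdd_above A"
      by (auto simp: real_of_struct_def bdd_above_def order.order_iff_strict)
    have "\<forall>a\<in>A. a \<le> Sup A" using bdd by (auto intro: cSup_upper)
    moreover have "Sup A \<le> b" if "\<forall>a\<in>A. a \<le> b" for b
      using that ne by (auto intro: cSup_least)
    ultimately show "\<exists>s\<in>carrier ?R. (\<forall>a\<in>A. a \<prec>\<^bsub>?R\<^esub> s \<or> a = s) \<and>
          (\<forall>b\<in>carrier ?R. (\<forall>a\<in>A. a \<prec>\<^bsub>?R\<^esub> b \<or> a = b) \<longrightarrow> s \<prec>\<^bsub>?R\<^esub> b \<or> s = b)"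
      unfolding real_of_struct_def
      by (intro bexI[of _ "Sup A"]) (auto simp: order.order_iff_strict)
  qed (auto simp: minus minv, auto simp: real_of_struct_def minv[unfolded real_of_struct_def])
qed

end

theory Submission
  imports Defs
begin

text \<open>Completeness of a structure depends only on which pairs of elements are closer than
  which tolerances. Two structures are therefore complete simultaneously as soon as their
  elements and, independently of these, their tolerances can be matched bijectively so that
  positivity of tolerances and the relation ``closer than'' are preserved
  (\<open>complete_struct_iff_if_closeness_preserved\<close>). Both equivalences are instances.

  For the external and the internal representation, elements and tolerances are both matched by
  the renaming, which is injective because it is multiplication by the inverse of \<open>r\<close>. For \<open>R\<close>
  and its external representation, the elements are matched by the identity, because subtraction
  is unchanged. If \<open>r\<close> is positive, so are the tolerances. If \<open>r\<close> is negative, the order is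
  reversed and the absolute value changes sign, so that \<open>\<bar>z\<bar> \<prec> \<epsilon>\<close> in \<open>R\<close> says the same as
  \<open>\<bar>z\<bar> \<prec> \<ominus> \<epsilon>\<close> in the external representation: tolerances are matched by negation.\<close>

text \<open>The tolerances are matched by a map \<open>e\<close> separate from the map \<open>p\<close> of the elements, so that
  the lemma covers an order reversal, where \<open>p\<close> is the identity and \<open>e\<close> is negation.\<close>

lemma complete_struct_iff_if_closeness_preserved:
  fixes S :: "'a of_struct" and T :: "'b of_struct"
  assumes p: "bij_betw p (carrier S) (carrier T)"
    and e: "bij_betw e (carrier S) (carrier T)"
    and pos: "\<And>\<epsilon>. \<epsilon> \<in> carrier S \<Longrightarrow> \<zero>\<^bsub>T\<^esub> \<prec>\<^bsub>T\<^esub> e \<epsilon> \<longleftrightarrow> \<zero>\<^bsub>S\<^esub> \<prec>\<^bsub>S\<^esub> \<epsilon>"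
    and close: "\<And>x y \<epsilon>. \<lbrakk>x \<in> carrier S; y \<in> carrier S; \<epsilon> \<in> carrier S\<rbrakk> \<Longrightarrow>
      abs_val T (diff T (p x) (p y)) \<prec>\<^bsub>T\<^esub> e \<epsilon> \<longleftrightarrow> abs_val S (diff S x y) \<prec>\<^bsub>S\<^esub> \<epsilon>"
  shows "complete_struct T \<longleftrightarrow> complete_struct S"
proof -
  have ball_e: "(\<forall>\<epsilon>\<in>carrier T. Q \<epsilon>) \<longleftrightarrow> (\<forall>\<epsilon>\<in>carrier S. Q (e \<epsilon>))" for Q
    unfolding bij_betw_imp_surj_on[OF e, symmetric] by blast
  have bex_p: "(\<exists>\<mu>\<in>carrier T. Q \<mu>) \<longleftrightarrow> (\<exists>\<mu>\<in>carrier S. Q (p \<mu>))" for Q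
    unfolding bij_betw_imp_surj_on[OF p, symmetric] by blast
  have conv: "converges T (\<lambda>j. p (x j)) \<longleftrightarrow> converges S x"
    if "\<forall>j. x j \<in> carrier S" for x
    using that by (simp add: converges_def ball_e pos close)
  have lim: "has_limit T (\<lambda>j. p (x j)) (p \<mu>) \<longleftrightarrow> has_limit S x \<mu>"
    if "\<forall>j. x j \<in> carrier S" "\<mu> \<in> carrier S" for x \<mu>
    using that by (simp add: has_limit_def ball_e pos close)
  have seqs: "(\<forall>y. (\<forall>j. y j \<in> carrier T) \<longrightarrow> Q y) \<longleftrightarrow>
      (\<forall>x. (\<forall>j. x j \<in> carrier S) \<longrightarrow> Q (\<lambda>j. p (x j)))" for Q :: "(nat \<Rightarrow> 'b) \<Rightarrow> bool"
  proof (intro iffI allI impI)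
    fix x :: "nat \<Rightarrow> 'a"
    assume "\<forall>y. (\<forall>j. y j \<in> carrier T) \<longrightarrow> Q y" "\<forall>j. x j \<in> carrier S"
    then show "Q (\<lambda>j. p (x j))" using bij_betwE[OF p] by simp
  next
    fix y :: "nat \<Rightarrow> 'b"
    assume Q: "\<forall>x. (\<forall>j. x j \<in> carrier S) \<longrightarrow> Q (\<lambda>j. p (x j))" and "\<forall>j. y j \<in> carrier T"
    then have "\<forall>j. \<exists>a\<in>carrier S. y j = p a"
      using bij_betw_imp_surj_on[OF p] by blast
    then obtain x where "\<forall>j. x j \<in> carrier S" "\<forall>j. y j = p (x j)" by metis
    then show "Q y" using Q by presburger
  qed
  show ?thesis
    unfolding complete_struct_def seqs bex_p by (auto simp: conv lim)
qed

lemma complete_struct_transport: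
  assumes inj: "inj_on f (carrier S)" and zero: "\<zero>\<^bsub>S\<^esub> \<in> carrier S"
    and diff: "\<And>x y. \<lbrakk>x \<in> carrier S; y \<in> carrier S\<rbrakk> \<Longrightarrow> diff S x y \<in> carrier S"
  shows "complete_struct (transport f S) \<longleftrightarrow> complete_struct S"
proof (rule complete_struct_iff_if_closeness_preserved)
  \<comment> \<open>The same map serves the elements and the tolerances.\<close>
  show "bij_betw f (carrier S) (carrier (transport f S))"
    and "bij_betw f (carrier S) (carrier (transport f S))"
    using inj by (simp_all add: bij_betw_def transport_def Let_def)
  fix x y \<epsilon> assume x: "x \<in> carrier S" and y: "y \<in> carrier S" and \<epsilon>: "\<epsilon> \<in> carrier S"
  have "abs_val (transport f S) (f z) = f (abs_val S z)" if "z \<in> carrier S" for z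
    using that inj zero by (simp add: abs_val_def transport_def Let_def)
  moreover have "abs_val S z \<in> carrier S" if "z \<in> carrier S" for z
    using that zero diff by (simp add: abs_val_def)
  moreover have "diff (transport f S) (f x) (f y) = f (diff S x y)"
    using x y inj by (simp add: transport_def Let_def)
  ultimately show "abs_val (transport f S) (diff (transport f S) (f x) (f y))
      \<prec>\<^bsub>transport f S\<^esub> f \<epsilon> \<longleftrightarrow> abs_val S (diff S x y) \<prec>\<^bsub>S\<^esub> \<epsilon>"
    using x y \<epsilon> inj diff by (simp add: transport_def Let_def)
qed (use inj zero in \<open>simp add: transport_def Let_def\<close>)

context real_structure
begin

lemma diff_closed: "\<lbrakk>x \<in> carrier R; y \<in> carrier R\<rbrakk> \<Longrightarrow> diff R x y \<in> carrier R"
  by (simp add: diff_eq)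

lemma abs_val_closed: "x \<in> carrier R \<Longrightarrow> abs_val R x \<in> carrier R"
  by (simp add: abs_val_def diff_closed)

lemma inj_on_rename:
  assumes r: "r \<in> carrier R" "r \<noteq> \<zero>"
  shows "inj_on (rename R r) (carrier R)"
proof (rule inj_onI)
  fix x y assume xy: "x \<in> carrier R" "y \<in> carrier R" and eq: "rename R r x = rename R r y"
  have u: "r \<in> Units R" using r field_Units by auto
  have "x \<otimes> inv r = y \<otimes> inv r" using eq xy r by (simp add: rename_def quot_eq)
  then have "x \<otimes> inv r \<otimes> r = y \<otimes> inv r \<otimes> r" by simp
  then show "x = y" using xy r u by (simp add: m_assoc)
qed

lemma minus_less_minus:
  assumes "x \<in> carrier R" "y \<in> carrier R" "x \<prec> y"
  shows "\<ominus> y \<prec> \<ominus> x"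
proof -
  have "x \<oplus> (\<ominus> x \<oplus> \<ominus> y) \<prec> y \<oplus> (\<ominus> x \<oplus> \<ominus> y)"
    using assms by (intro add_less_mono) auto
  moreover have "x \<oplus> (\<ominus> x \<oplus> \<ominus> y) = \<ominus> y" using assms by (simp add: r_neg2)
  moreover have "y \<oplus> (\<ominus> x \<oplus> \<ominus> y) = \<ominus> x" 
    using assms by (simp add: a_comm[of "\<ominus> x" "\<ominus> y"] r_neg2)
  ultimately show ?thesis by simp
qed

lemma minus_less_minus_iff:
  assumes "x \<in> carrier R" "y \<in> carrier R"
  shows "\<ominus> y \<prec> \<ominus> x \<longleftrightarrow> x \<prec> y"
  using minus_less_minus[of x y] minus_less_minus[of "\<ominus> y" "\<ominus> x"] assms by auto

lemma bij_betw_a_inv: "bij_betw (a_inv R) (carrier R) (carrier R)"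
  by (rule bij_betwI[where g = "a_inv R"]) auto

lemma complete_struct_external_rep:
  assumes r: "r \<in> carrier R" "r \<noteq> \<zero>"
  shows "complete_struct (external_rep R r) \<longleftrightarrow> complete_struct R"
proof (cases "\<zero> \<prec> r")
  case True
  show ?thesis
    by (rule complete_struct_iff_if_closeness_preserved[where p = id and e = id])
      (use True in \<open>auto simp: abs_val_external_rep_pos\<close>, auto simp: external_rep_def)
next
  case False
  then have neg: "r \<prec> \<zero>" using r less_linear[of r \<zero>] by auto
  show ?thesis
  proof (rule complete_struct_iff_if_closeness_preserved[where p = id and e = "a_inv R"])
    show "bij_betw (a_inv R) (carrier R) (carrier (external_rep R r))"
      using bij_betw_a_inv by (simp add: external_rep_def)
    show "\<zero>\<^bsub>external_rep R r\<^esub> \<prec>\<^bsub>external_rep R r\<^esub> \<ominus> \<epsilon> \<longleftrightarrow> \<zero> \<prec> \<epsilon>"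
      if "\<epsilon> \<in> carrier R" for \<epsilon>
      using that False minus_less_minus_iff[of \<zero> \<epsilon>] by (simp add: external_rep_def)
    fix x y \<epsilon> assume xy: "x \<in> carrier R" "y \<in> carrier R" and \<epsilon>: "\<epsilon> \<in> carrier R"
    have "diff (external_rep R r) (id x) (id y) = diff R x y" by (simp add: external_rep_def)
    then have "abs_val (external_rep R r) (diff (external_rep R r) (id x) (id y)) =
        \<ominus> abs_val R (diff R x y)"
      using abs_val_external_rep_neg[OF r(1) neg] xy by (simp add: diff_closed)
    moreover have "a \<prec>\<^bsub>external_rep R r\<^esub> b \<longleftrightarrow> b \<prec> a" for a b
      using False by (simp add: external_rep_def)
    ultimately show "abs_val (external_rep R r) (diff (external_rep R r) (id x) (id y))
        \<prec>\<^bsub>external_rep R r\<^esub> \<ominus> \<epsilon> \<longleftrightarrow> abs_val R (diff R x y) \<prec> \<epsilon>"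
      using xy \<epsilon> by (simp add: minus_less_minus_iff abs_val_closed diff_closed)
  qed (simp add: external_rep_def)
qed

lemma complete_struct_internal_rep:
  assumes "r \<in> carrier R" "r \<noteq> \<zero>"
  shows "complete_struct (internal_rep R r) \<longleftrightarrow> complete_struct (external_rep R r)"
  unfolding internal_rep_def
  by (rule complete_struct_transport)
    (use assms inj_on_rename diff_closed in \<open>auto simp: external_rep_def\<close>)

end

theorem theorem7:
  fixes R :: "'a of_struct" and r :: 'a
  assumes "real_structure R" and "r \<in> carrier R" and "r \<noteq> \<zero>\<^bsub>R\<^esub>"
  shows "(complete_struct (internal_rep R r) \<longleftrightarrow> complete_struct (external_rep R r)) \<and>
    (complete_struct (external_rep R r) \<longleftrightarrow> complete_struct R)"
  using real_structure.complete_struct_internal_rep[OF assms]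
    real_structure.complete_struct_external_rep[OF assms] by blast

end
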